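(* Let $f:\mathbb{R}\to\mathbb{R}$ be a continuous map and let $I_1,\ldots,I_5\subset\mathbb{R}$ be closed bounded intervals such that $(I_1,\ldots,I_5;f)$ is a covering system, i.e. $f(I_1\cup\cdots\cup I_5)\supseteq I_1\cup\cdots\cup I_5$. Then there exist a point $x_0\in I_1\cup\cdots\cup I_5$ and an integer $l$ with $1\le l\le 5$ such that $f^l(x_0)=x_0$.
   Context: $f^l$ denotes the $l$-th iterate of $f$. For a continuous map $f:\mathbb{R}\to\mathbb{R}$ and closed bounded intervals $I_1,\ldots,I_k$ of $\mathbb{R}$, the tuple $(I_1,\ldots,I_k;f)$ is called a covering system if $f(I_1\cup\cdots\cup I_k)\supseteq I_1\cup\cdots\cup I_k$. *)

theory Defs
  imports "HOL-Analysis.Analysis"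
begin

(* Degenerate intervals {a} are allowed, the empty set is not. *)
definition closed_bounded_interval :: "real set \<Rightarrow> bool" where
  "closed_bounded_interval J \<longleftrightarrow> (\<exists>a b. a \<le> b \<and> J = {a..b})"

(* The tuple (I 1, ..., I k; f); values of I at indices outside {1..k} are irrelevant. *)
definition covering_system :: "nat \<Rightarrow> (nat \<Rightarrow> real set) \<Rightarrow> (real \<Rightarrow> real) \<Rightarrow> bool" where
  "covering_system k I f \<longleftrightarrow>
     continuous_on UNIV f \<and>
     (\<forall>i\<in>{1..k}. closed_bounded_interval (I i)) \<and>
     f ` (\<Union>i\<in>{1..k}. I i) \<supseteq> (\<Union>i\<in>{1..k}. I i)"

end

theory Submission
  imports Defs "Jordan_Normal_Form.Schur_Decomposition"
begin

text \<open>The argument works for any number \<open>n\<close> of compact intervals with union \<open>U\<close>, and produces a point of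
\<open>U\<close> of period at most \<open>n\<close>.

First, it suffices to treat maps \<open>g\<close> with a finite nonempty invariant set \<open>P \<subseteq> U\<close>. Indeed, since
\<open>f ` U \<supseteq> U\<close>, there are infinite backward orbits in \<open>U\<close>; two of their terms are arbitrarily close, and an
arbitrarily small change of \<open>f\<close> turns the segment between them into an invariant set
(\<open>close_map_with_finite_invariant_set\<close>). Points of \<open>U\<close> fixed by an \<open>l\<close>-th iterate survive in the limit
(\<open>no_periodic_point_stable\<close>).

For such a \<open>g\<close>, assume that no point of \<open>P\<close> has a period up to \<open>n\<close>. List the points of \<open>P\<close> as
\<open>p 0 < \<dots> < p r\<close> and let \<open>M\<close> be the matrix, indexed by the \<open>r\<close> gaps between consecutive points, that
records with a sign which gaps the image of a gap must cross. The trace of \<open>M\<^sup>k\<close> counts, with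
signs, the gaps that are crossed by their own image under \<open>g ^^ k\<close>. For \<open>1 \<le> k \<le> n\<close> it
is \<open>-1\<close>, by telescoping (\<open>trace_mpow_gap_matrix\<close>).

At most \<open>n - 1\<close> gaps are good, meaning that their endpoints lie in no common interval
(\<open>card_separating_gaps\<close>); all others are contained in \<open>U\<close>. If each loop of length at most \<open>n\<close> in
the covering graph used good gaps only, then the submatrix of \<open>M\<close> on the good gaps would also have
the traces \<open>-1\<close> for \<open>1 \<le> k \<le> n\<close>. But then its at most \<open>n - 1\<close> eigenvalues, together with the number
\<open>1\<close>, would have vanishing power sums of exponents \<open>1, \<dots>, n\<close>, which forces all of these numbers to be
zero (\<open>mpow_traces_ne_minus_one\<close>). So some gap inside \<open>U\<close> covers itself under an iterate
\<open>g ^^ l\<close> with \<open>1 \<le> l \<le> n\<close>, and by the intermediate value theorem it contains a fixed point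
of that iterate.\<close>

section \<open>Matrices whose powers have trace minus one\<close>

text \<open>Matrices are indexed by arbitrary finite sets rather than by initial segments of \<open>nat\<close>, so that
a square submatrix is obtained just by shrinking the index set.\<close>
primrec mpow :: "'i set \<Rightarrow> ('i \<Rightarrow> 'i \<Rightarrow> complex) \<Rightarrow> nat \<Rightarrow> 'i \<Rightarrow> 'i \<Rightarrow> complex" where
  "mpow S M 0 i j = of_bool (i = j)"
| "mpow S M (Suc k) i j = (\<Sum>h\<in>S. mpow S M k i h * M h j)"

text \<open>\<open>A = P * (B * Q)\<close> and \<open>B = (B * Q) * P\<close> are products of the same two factors in opposite order.\<close>
lemma similar_mat_sum_diag_eq:
  fixes A B :: "complex mat"
  assumes A: "A \<in> carrier_mat m m" and AB: "similar_mat_wit A B P Q"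
  shows "(\<Sum>i<m. A $$ (i,i)) = (\<Sum>i<m. B $$ (i,i))"
proof -
  note w = similar_mat_witD2[OF A AB]
  have c: "P \<in> carrier_mat m m" "Q \<in> carrier_mat m m" "B \<in> carrier_mat m m" 
    using w by auto
  have BQ: "B * Q \<in> carrier_mat m m" using c by auto
  have comm: "(\<Sum>i<m. (X * Y) $$ (i,i)) = (\<Sum>i<m. (Y * X) $$ (i,i))"
    if "X \<in> carrier_mat m m" "Y \<in> carrier_mat m m" for X Y :: "complex mat"
  proof -
    have "(\<Sum>i<m. (X * Y) $$ (i,i)) = (\<Sum>i<m. \<Sum>j<m. X $$ (i,j) * Y $$ (j,i))"
      using that by (auto simp: scalar_prod_def atLeast0LessThan intro!: sum.cong)
    also have "\<dots> = (\<Sum>j<m. \<Sum>i<m. X $$ (i,j) * Y $$ (j,i))" by (rule sum.swap)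
    also have "\<dots> = (\<Sum>i<m. (Y * X) $$ (i,i))"
      using that by (auto simp: scalar_prod_def atLeast0LessThan mult.commute intro!: sum.cong)
    finally show ?thesis .
  qed
  have "A = P * (B * Q)" using w c by (simp add: assoc_mult_mat[of _ m m _ m _ m])
  then have "(\<Sum>i<m. A $$ (i,i)) = (\<Sum>i<m. (B * Q * P) $$ (i,i))"
    using comm[OF c(1) BQ] by simp
  also have "B * Q * P = B" using c w by (simp add: assoc_mult_mat[of _ m m _ m _ m])
  finally show ?thesis .
qed

lemma upper_triangular_pow:
  fixes B :: "complex mat"
  assumes B: "B \<in> carrier_mat m m" and ut: "upper_triangular B"
  shows "upper_triangular (B ^\<^sub>m k) \<and> (\<forall>i<m. (B ^\<^sub>m k) $$ (i,i) = (B $$ (i,i)) ^ k)"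
proof (induction k)
  case 0
  then show ?case using B by auto
next
  case (Suc k)
  let ?C = "B ^\<^sub>m k"
  have C: "?C \<in> carrier_mat m m" using B by simp
  have entry: "(?C * B) $$ (i,j) = (\<Sum>h<m. ?C $$ (i,h) * B $$ (h,j))" if "i < m" "j < m" for i j
    using that B C by (auto simp: scalar_prod_def atLeast0LessThan intro!: sum.cong)
  have z: "?C $$ (i,h) * B $$ (h,j) = 0" if "i < m" "h < m" "j < h \<or> h < i" for i j h
    using that(3)
  proof
    assume "j < h"
    then have "B $$ (h,j) = 0" using upper_triangularD[OF ut] that B by auto
    then show ?thesis by simp
  next
    assume "h < i"
    then have "?C $$ (i,h) = 0" using upper_triangularD[of ?C h i] Suc that C by auto
    then show ?thesis by simp
  qed
  have "upper_triangular (?C * B)"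
  proof (rule upper_triangularI)
    fix i j assume ij: "j < i" "i < dim_row (?C * B)"
    then have "i < m" "j < m" using C by auto
    then have "(?C * B) $$ (i,j) = (\<Sum>h<m. ?C $$ (i,h) * B $$ (h,j))" by (rule entry)
    also have "\<dots> = 0" using ij \<open>i < m\<close> by (intro sum.neutral ballI z) auto
    finally show "(?C * B) $$ (i,j) = 0" .
  qed
  moreover have "(?C * B) $$ (i,i) = (B $$ (i,i)) ^ Suc k" if i: "i < m" for i
  proof -
    have "(?C * B) $$ (i,i) = (\<Sum>h<m. ?C $$ (i,h) * B $$ (h,i))" using i by (intro entry)
    also have "\<dots> = (\<Sum>h\<in>{i}. ?C $$ (i,h) * B $$ (h,i))"
      using i by (intro sum.mono_neutral_right) (use z[of i _ i] in force)+
    finally show ?thesis using Suc i by simp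
  qed
  ultimately show ?case by simp
qed

text \<open>The \<open>e i\<close> are the eigenvalues with multiplicity, read off the diagonal of a triangular form.\<close>
lemma trace_pow_eq_power_sum:
  fixes A :: "complex mat"
  assumes A: "A \<in> carrier_mat m m"
  obtains e where "\<And>k. (\<Sum>i<m. (A ^\<^sub>m k) $$ (i,i)) = (\<Sum>i<m. e i ^ k)"
proof -
  from char_poly_factorized[OF A] obtain es where "char_poly A = (\<Prod>a\<leftarrow>es. [:- a, 1:])" by blast
  from schur_decomposition_exists[OF A this] obtain B P Q
    where B: "B \<in> carrier_mat m m" "upper_triangular B" and w: "similar_mat_wit A B P Q"
    unfolding similar_mat_def by blast
  show ?thesis
  proof (rule that[of "\<lambda>i. B $$ (i,i)"])
    fix k
    have "(\<Sum>i<m. (A ^\<^sub>m k) $$ (i,i)) = (\<Sum>i<m. (B ^\<^sub>m k) $$ (i,i))"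
      using A by (intro similar_mat_sum_diag_eq[OF _ similar_mat_wit_pow[OF w]]) simp
    then show "(\<Sum>i<m. (A ^\<^sub>m k) $$ (i,i)) = (\<Sum>i<m. (B $$ (i,i)) ^ k)"
      using upper_triangular_pow[OF B, of k] by simp
  qed
qed

text \<open>Together with the extra number \<open>1\<close>, the \<open>e i\<close> would be \<open>m + 1\<close> complex numbers whose power sums of
exponents \<open>1, \<dots>, m + 1\<close> vanish. Then the sum of the values of \<open>q\<close> at these numbers vanishes for each
polynomial \<open>q\<close> of degree at most \<open>m + 1\<close> without constant term. Taking for \<open>q\<close> a polynomial that
is zero at all \<open>e i\<close> other than \<open>1\<close>, but not at \<open>1\<close>, leaves a positive multiple of \<open>q(1)\<close>.\<close>
lemma power_sums_ne_minus_one: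
  fixes e :: "nat \<Rightarrow> complex"
  assumes ps: "\<And>k. 1 \<le> k \<Longrightarrow> k \<le> Suc m \<Longrightarrow> (\<Sum>i<m. e i ^ k) = -1"
  shows False
proof -
  define q where "q = [:0, 1:] * (\<Prod>v\<in>e ` {..<m} - {0, 1}. [:- v, 1:])"
  have fin: "finite (e ` {..<m} - {0, 1})" by simp
  have "degree (\<Prod>v\<in>e ` {..<m} - {0, 1}. [:- v, 1:]) \<le> (\<Sum>v\<in>e ` {..<m} - {0, 1}. degree [:- v, 1:])"
    using degree_prod_sum_le[OF fin, of "\<lambda>v. [:- v, 1:]"] by (simp add: o_def)
  also have "\<dots> \<le> card (e ` {..<m})" by (simp add: card_mono)
  also have "\<dots> \<le> m" using card_image_le[of "{..<m}" e] by simp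
  finally have deg: "degree q \<le> Suc m"
    unfolding q_def using degree_mult_le[of "[:0, 1:]" "(\<Prod>v\<in>e ` {..<m} - {0, 1}. [:- v, 1:])"] by simp
  have poly_sum: "poly q x = (\<Sum>k\<le>Suc m. coeff q k * x ^ k)" for x
    unfolding poly_altdef using deg
    by (intro sum.mono_neutral_left) (auto simp: coeff_eq_0)
  have q0: "coeff q 0 = 0" by (simp add: q_def)
  have q1: "poly q 1 \<noteq> 0" using fin by (auto simp: q_def poly_prod)
  have qe: "poly q (e i) = (if e i = 1 then poly q 1 else 0)" if "i < m" for i
    using that fin by (auto simp: q_def poly_prod)
  have "(\<Sum>i<m. poly q (e i)) = (\<Sum>i<m. \<Sum>k\<le>Suc m. coeff q k * e i ^ k)"
    by (simp only: poly_sum)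
  also have "\<dots> = (\<Sum>k\<le>Suc m. coeff q k * (\<Sum>i<m. e i ^ k))"
    by (subst sum.swap) (simp add: sum_distrib_left)
  also have "\<dots> = (\<Sum>k\<le>Suc m. - (coeff q k * 1 ^ k))"
  proof (rule sum.cong)
    fix k assume "k \<in> {..Suc m}"
    then show "coeff q k * (\<Sum>i<m. e i ^ k) = - (coeff q k * 1 ^ k)"
      using ps[of k] q0 by (cases "k = 0") auto
  qed simp
  also have "\<dots> = - poly q 1"
    by (simp only: poly_sum sum_negf)
  finally have *: "(\<Sum>i<m. poly q (e i)) = - poly q 1" .
  have "(\<Sum>i<m. poly q (e i)) = (\<Sum>i<m. if e i = 1 then poly q 1 else 0)"
    by (intro sum.cong) (auto simp: qe)
  also have "\<dots> = of_nat (card {i\<in>{..<m}. e i = 1}) * poly q 1"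
    by (simp add: sum.If_cases Int_def)
  finally have "of_nat (card {i\<in>{..<m}. e i = 1}) * poly q 1 = - poly q 1" using * by simp
  then have "of_nat (Suc (card {i\<in>{..<m}. e i = 1})) * poly q 1 = 0"
    by (simp only: of_nat_Suc distrib_right) simp
  with q1 show False by (metis mult_eq_0_iff of_nat_eq_0_iff nat.distinct(1))
qed

text \<open>The range of exponents is sharp: the companion matrix of \<open>1 + t + \<dots> + t\<^sup>m\<close>, whose eigenvalues
are the nontrivial roots of unity of order \<open>m + 1\<close>, has trace \<open>-1\<close> for all exponents up to \<open>m\<close>.\<close>
lemma mpow_traces_ne_minus_one:
  fixes M :: "'i \<Rightarrow> 'i \<Rightarrow> complex"
  assumes S: "finite S" and tr: "\<And>k. 1 \<le> k \<Longrightarrow> k \<le> Suc (card S) \<Longrightarrow> (\<Sum>i\<in>S. mpow S M k i i) = -1"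
  shows False
proof -
  define m where "m = card S"
  obtain h where h: "bij_betw h {..<m} S"
    using ex_bij_betw_nat_finite[OF S] by (auto simp: m_def atLeast0LessThan)
  define A where "A = mat m m (\<lambda>(i,j). M (h i) (h j))"
  have A: "A \<in> carrier_mat m m" by (simp add: A_def)
  have Apow: "(A ^\<^sub>m k) $$ (i,j) = mpow S M k (h i) (h j)" if "i < m" "j < m" for k i j
    using that
  proof (induction k arbitrary: j)
    case 0
    then show ?case using A h by (auto simp: bij_betw_def inj_on_def)
  next
    case (Suc k)
    have "(A ^\<^sub>m Suc k) $$ (i,j) = (\<Sum>l<m. (A ^\<^sub>m k) $$ (i,l) * A $$ (l,j))"
      using Suc.prems A by (auto simp: scalar_prod_def atLeast0LessThan intro!: sum.cong)
    also have "\<dots> = (\<Sum>l<m. mpow S M k (h i) (h l) * M (h l) (h j))"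
      using Suc by (auto simp: A_def intro!: sum.cong)
    also have "\<dots> = mpow S M (Suc k) (h i) (h j)"
      using sum.reindex_bij_betw[OF h, of "\<lambda>l. mpow S M k (h i) l * M l (h j)"] by simp
    finally show ?case .
  qed
  from trace_pow_eq_power_sum[OF A] obtain e
    where e: "\<And>k. (\<Sum>i<m. (A ^\<^sub>m k) $$ (i,i)) = (\<Sum>i<m. e i ^ k)" by blast
  show False
  proof (rule power_sums_ne_minus_one)
    fix k assume k: "1 \<le> k" "k \<le> Suc m"
    have "(\<Sum>i<m. e i ^ k) = (\<Sum>i<m. mpow S M k (h i) (h i))"
      by (simp add: e[symmetric] Apow)
    also have "\<dots> = (\<Sum>i\<in>S. mpow S M k i i)"
      by (rule sum.reindex_bij_betw[OF h])
    finally show "(\<Sum>i<m. e i ^ k) = -1" using tr k by (simp add: m_def)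
  qed
qed

section \<open>The signed covering matrix of a self-map of a finite chain\<close>

text \<open>Gap \<open>i\<close> of the chain \<open>0 < 1 < \<dots> < r\<close> is the segment from \<open>i\<close> to \<open>i + 1\<close>. A continuous extension
of \<open>\<sigma>\<close> maps it across all gaps between \<open>\<sigma> i\<close> and \<open>\<sigma> (i + 1)\<close>; the entry is \<open>1\<close> or \<open>-1\<close> when gap
\<open>j\<close> is among them, according to the direction of travel, and \<open>0\<close> otherwise. Writing it as a difference
of two indicators makes sums over \<open>j\<close> telescope.\<close>
definition gap_matrix :: "(nat \<Rightarrow> nat) \<Rightarrow> nat \<Rightarrow> nat \<Rightarrow> complex" where
  "gap_matrix \<sigma> i j = of_bool (j < \<sigma> (Suc i)) - of_bool (j < \<sigma> i)"

lemma funpow_mem: "(\<And>x. x \<in> A \<Longrightarrow> h x \<in> A) \<Longrightarrow> x \<in> A \<Longrightarrow> (h ^^ k) x \<in> A"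
  by (induction k) auto

text \<open>The signed covering matrix is functorial: its \<open>k\<close>-th power is the covering matrix of \<open>\<sigma> ^^ k\<close>, since
backtracking cancels.\<close>
lemma mpow_gap_matrix:
  assumes \<sigma>: "\<And>i. i \<le> r \<Longrightarrow> \<sigma> i \<le> r" and "i < r" "j < r"
  shows "mpow {..<r} (gap_matrix \<sigma>) k i j = of_bool (j < (\<sigma> ^^ k) (Suc i)) - of_bool (j < (\<sigma> ^^ k) i)"
  using \<open>j < r\<close>
proof (induction k arbitrary: j)
  case 0
  then show ?case by (auto simp: less_Suc_eq)
next
  case (Suc k)
  define F :: "nat \<Rightarrow> complex" where "F = (\<lambda>x. of_bool (j < \<sigma> x))"
  have tel: "(\<Sum>h<r. of_bool (h < b) * (F (Suc h) - F h)) = F b - F 0" if "b \<le> r" for b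
  proof -
    have "(\<Sum>h<r. of_bool (h < b) * (F (Suc h) - F h)) = (\<Sum>h<b. F (Suc h) - F h)"
      using that by (intro sum.mono_neutral_cong_right) auto
    then show ?thesis by (simp add: sum_lessThan_telescope)
  qed
  have le: "(\<sigma> ^^ k) x \<le> r" if "x \<le> r" for x
    using funpow_mem[of "{..r}" \<sigma> x k] \<sigma> that by auto
  have "mpow {..<r} (gap_matrix \<sigma>) (Suc k) i j
      = (\<Sum>h<r. (of_bool (h < (\<sigma> ^^ k) (Suc i)) - of_bool (h < (\<sigma> ^^ k) i)) * (F (Suc h) - F h))"
    by (simp add: Suc.IH F_def gap_matrix_def[of \<sigma> _ j])
  also have "\<dots> = (F ((\<sigma> ^^ k) (Suc i)) - F 0) - (F ((\<sigma> ^^ k) i) - F 0)"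
    using le[of "Suc i"] le[of i] \<open>i < r\<close>
    by (simp only: left_diff_distrib sum_subtractf tel less_imp_le Suc_leI)
  finally show ?case by (simp add: F_def)
qed

text \<open>On the diagonal, the entry of gap \<open>i\<close> compares whether \<open>\<sigma> ^^ k\<close> moves \<open>i\<close> and \<open>i + 1\<close> upwards. The
smallest point must move up and the largest must move down, so the telescoping sum is \<open>-1\<close>.\<close>
lemma trace_mpow_gap_matrix:
  assumes \<sigma>: "\<And>i. i \<le> r \<Longrightarrow> \<sigma> i \<le> r" and nofix: "\<And>i. i \<le> r \<Longrightarrow> (\<sigma> ^^ k) i \<noteq> i"
  shows "(\<Sum>i<r. mpow {..<r} (gap_matrix \<sigma>) k i i) = -1"
proof -
  define D :: "nat \<Rightarrow> complex" where "D = (\<lambda>i. of_bool (i < (\<sigma> ^^ k) i))"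
  have "mpow {..<r} (gap_matrix \<sigma>) k i i = D (Suc i) - D i" if "i < r" for i
    using mpow_gap_matrix[of r \<sigma> i i k] \<sigma> that nofix[of "Suc i"] by (auto simp: D_def)
  then have "(\<Sum>i<r. mpow {..<r} (gap_matrix \<sigma>) k i i) = (\<Sum>i<r. D (Suc i) - D i)" by simp
  also have "\<dots> = D r - D 0" by (rule sum_lessThan_telescope)
  also have "D r = 0"
    using funpow_mem[of "{..r}" \<sigma> r k] \<sigma> by (auto simp: D_def)
  also have "D 0 = 1" using nofix[of 0] by (simp add: D_def)
  finally show ?thesis by simp
qed

definition arcs :: "'i set \<Rightarrow> ('i \<Rightarrow> 'i \<Rightarrow> complex) \<Rightarrow> ('i \<times> 'i) set" where
  "arcs S M = {(i, j). i \<in> S \<and> j \<in> S \<and> M i j \<noteq> 0}"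

lemma mpow_nonzero_imp_walk:
  assumes "i \<in> S" "j \<in> S" "mpow S M k i j \<noteq> 0"
  shows "(i, j) \<in> arcs S M ^^ k"
  using assms(2,3)
proof (induction k arbitrary: j)
  case 0
  then show ?case by (auto split: if_splits)
next
  case (Suc k)
  from Suc.prems obtain h where "h \<in> S" "mpow S M k i h * M h j \<noteq> 0"
    by (auto elim: sum.not_neutral_contains_not_neutral)
  then show ?case using Suc.IH[of h] Suc.prems by (auto simp: arcs_def)
qed

text \<open>An entry of a matrix power is a sum over walks. A walk from \<open>i\<close> to \<open>j\<close> that closes up to a loop
of length at most \<open>n\<close> cannot visit an index outside \<open>G\<close>, because the loop could then be
rotated to start at that index. Hence discarding these indices does not change the entry.\<close>
lemma mpow_restrict:
  assumes "finite S" "G \<subseteq> S"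
    and noloop: "\<And>b l. b \<in> S - G \<Longrightarrow> 1 \<le> l \<Longrightarrow> l \<le> n \<Longrightarrow> (b, b) \<notin> arcs S M ^^ l"
    and "i \<in> G" "j \<in> G" "(j, i) \<in> arcs S M ^^ m" "k + m \<le> n"
  shows "mpow S M k i j = mpow G M k i j"
  using assms(5-7)
proof (induction k arbitrary: j m)
  case 0
  then show ?case by simp
next
  case (Suc k)
  have "mpow S M k i h * M h j = 0" if h: "h \<in> S - G" for h
  proof (rule ccontr)
    assume *: "mpow S M k i h * M h j \<noteq> 0"
    then have "(i, h) \<in> arcs S M ^^ k" using h assms(2,4) by (intro mpow_nonzero_imp_walk) auto
    moreover have hj: "(h, j) \<in> arcs S M" using * h assms(2) Suc.prems by (auto simp: arcs_def)
    moreover have "(h, i) \<in> arcs S M ^^ Suc m" using hj Suc.prems by (intro relpow_Suc_I2)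
    ultimately have "(h, h) \<in> arcs S M ^^ (Suc m + k)" unfolding relpow_add by blast
    then show False using noloop[OF h, of "Suc m + k"] Suc.prems by auto
  qed
  then have "mpow S M (Suc k) i j = (\<Sum>h\<in>G. mpow S M k i h * M h j)"
    using assms(1,2) by (auto intro!: sum.mono_neutral_right)
  also have "\<dots> = (\<Sum>h\<in>G. mpow G M k i h * M h j)"
  proof (rule sum.cong)
    fix h assume h: "h \<in> G"
    show "mpow S M k i h * M h j = mpow G M k i h * M h j"
    proof (cases "M h j = 0")
      case False
      then have "(h, j) \<in> arcs S M" using h assms(2) Suc.prems by (auto simp: arcs_def)
      then have "(h, i) \<in> arcs S M ^^ Suc m" using Suc.prems by (intro relpow_Suc_I2)
      then show ?thesis using Suc.IH[OF h, of "Suc m"] Suc.prems by simp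
    qed simp
  qed simp
  finally show ?case by simp
qed

text \<open>If all loops of length at most \<open>n\<close> stayed inside \<open>G\<close>, then the submatrix on \<open>G\<close> would have the same
traces \<open>-1\<close> as the whole matrix for all exponents up to \<open>n\<close>, which is too many for its size.\<close>
lemma short_loop_outside:
  assumes \<sigma>: "\<And>i. i \<le> r \<Longrightarrow> \<sigma> i \<le> r"
    and nofix: "\<And>i l. i \<le> r \<Longrightarrow> 1 \<le> l \<Longrightarrow> l \<le> n \<Longrightarrow> (\<sigma> ^^ l) i \<noteq> i"
    and G: "G \<subseteq> {..<r}" "card G < n"
  obtains b l where "b < r" "b \<notin> G" "1 \<le> l" "l \<le> n" "(b, b) \<in> arcs {..<r} (gap_matrix \<sigma>) ^^ l"
proof (rule ccontr)
  assume "\<not> thesis"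
  with that have noloop: "(b, b) \<notin> arcs {..<r} (gap_matrix \<sigma>) ^^ l"
    if "b \<in> {..<r} - G" "1 \<le> l" "l \<le> n" for b l
    using that by auto
  show False
  proof (rule mpow_traces_ne_minus_one)
    show "finite G" using G finite_subset by blast
    fix k assume "1 \<le> k" "k \<le> Suc (card G)"
    then have k: "1 \<le> k" "k \<le> n" using G by auto
    have "mpow {..<r} (gap_matrix \<sigma>) k i i = 0" if "i \<in> {..<r} - G" for i
      using mpow_nonzero_imp_walk[of i "{..<r}" i "gap_matrix \<sigma>" k] noloop[OF that k] that by auto
    then have "(\<Sum>i<r. mpow {..<r} (gap_matrix \<sigma>) k i i) = (\<Sum>i\<in>G. mpow {..<r} (gap_matrix \<sigma>) k i i)"
      using G by (intro sum.mono_neutral_right) auto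
    also have "\<dots> = (\<Sum>i\<in>G. mpow G (gap_matrix \<sigma>) k i i)"
      using noloop k by (intro sum.cong mpow_restrict[where m = 0 and n = n] refl G) auto
    finally show "(\<Sum>i\<in>G. mpow G (gap_matrix \<sigma>) k i i) = -1"
      using trace_mpow_gap_matrix[of r \<sigma> k] \<sigma> nofix k by simp
  qed
qed

section \<open>Periodic points of a continuous map with a finite invariant set\<close>
lemma continuous_on_funpow:
  fixes f :: "'a::topological_space \<Rightarrow> 'a"
  assumes "continuous_on UNIV f"
  shows "continuous_on UNIV (f ^^ l)"
proof (induction l)
  case (Suc l)
  then show ?case using continuous_on_compose2[OF assms, of UNIV "f ^^ l"] by (simp add: o_def)
qed (simp add: id_def)

lemma self_covering_interval_fixpoint:
  fixes h :: "real \<Rightarrow> real"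
  assumes h: "continuous_on UNIV h" and "a \<le> b" and cov: "{a..b} \<subseteq> h ` {a..b}"
  obtains x where "x \<in> {a..b}" "h x = x"
proof -
  have "a \<in> h ` {a..b}" "b \<in> h ` {a..b}" using cov \<open>a \<le> b\<close> by auto
  then obtain u v where uv: "u \<in> {a..b}" "h u = a" "v \<in> {a..b}" "h v = b" by auto
  define d where "d = (\<lambda>x. h x - x)"
  have "continuous_on {a..b} d"
    unfolding d_def using h by (intro continuous_intros) (auto intro: continuous_on_subset)
  then have "connected (d ` {a..b})" by (intro connected_continuous_image) auto
  moreover have "d u \<in> d ` {a..b}" "d v \<in> d ` {a..b}" using uv by auto
  ultimately have "{d u..d v} \<subseteq> d ` {a..b}" by (rule connected_contains_Icc)
  moreover have "0 \<in> {d u..d v}" using uv by (auto simp: d_def)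
  ultimately have "0 \<in> d ` {a..b}" by blast
  then show ?thesis using that by (auto simp: d_def)
qed

text \<open>Each arc is a covering relation by the intermediate value theorem. Images of iterates compose,
so no nested sequence of subintervals has to be chosen along the walk.\<close>
lemma walk_imp_covers:
  fixes g :: "real \<Rightarrow> real"
  assumes g: "continuous_on UNIV g"
    and p: "\<And>i j. i \<le> j \<Longrightarrow> j \<le> r \<Longrightarrow> p i \<le> p j"
    and \<sigma>: "\<And>i. i \<le> r \<Longrightarrow> \<sigma> i \<le> r" "\<And>i. i \<le> r \<Longrightarrow> g (p i) = p (\<sigma> i)"
    and walk: "(i, j) \<in> arcs {..<r} (gap_matrix \<sigma>) ^^ l"
  shows "{p j..p (Suc j)} \<subseteq> (g ^^ l) ` {p i..p (Suc i)}"
  using walk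
proof (induction l arbitrary: j)
  case 0
  then show ?case by simp
next
  case (Suc l)
  then obtain h where walk: "(i, h) \<in> arcs {..<r} (gap_matrix \<sigma>) ^^ l"
    and arc: "(h, j) \<in> arcs {..<r} (gap_matrix \<sigma>)" by auto
  let ?J = "g ` {p h..p (Suc h)}"
  have hj: "h < r" "j < r" and "gap_matrix \<sigma> h j \<noteq> 0" using arc by (auto simp: arcs_def)
  then consider "\<sigma> h \<le> j" "Suc j \<le> \<sigma> (Suc h)" | "\<sigma> (Suc h) \<le> j" "Suc j \<le> \<sigma> h"
    by (fastforce simp: gap_matrix_def not_less split: if_splits)
  moreover have "connected ?J"
    using g by (intro connected_continuous_image) (auto intro: continuous_on_subset)
  moreover have "p (\<sigma> h) \<in> ?J" "p (\<sigma> (Suc h)) \<in> ?J"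
  proof -
    have "p h \<le> p (Suc h)" using hj by (intro p) auto
    then have "g (p h) \<in> ?J" "g (p (Suc h)) \<in> ?J" by auto
    then show "p (\<sigma> h) \<in> ?J" "p (\<sigma> (Suc h)) \<in> ?J" using hj by (simp_all add: \<sigma>(2))
  qed
  ultimately have "{p j..p (Suc j)} \<subseteq> ?J"
  proof cases
    case 1
    then have "p (\<sigma> h) \<le> p j" "p (Suc j) \<le> p (\<sigma> (Suc h))"
      using hj \<sigma>(1)[of "Suc h"] by (auto intro!: p)
    then show ?thesis
      using connected_contains_Icc[OF \<open>connected ?J\<close> \<open>p (\<sigma> h) \<in> ?J\<close> \<open>p (\<sigma> (Suc h)) \<in> ?J\<close>] by auto
  next
    case 2
    then have "p (\<sigma> (Suc h)) \<le> p j" "p (Suc j) \<le> p (\<sigma> h)"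
      using hj \<sigma>(1)[of h] by (auto intro!: p)
    then show ?thesis
      using connected_contains_Icc[OF \<open>connected ?J\<close> \<open>p (\<sigma> (Suc h)) \<in> ?J\<close> \<open>p (\<sigma> h) \<in> ?J\<close>] by auto
  qed
  also have "\<dots> \<subseteq> g ` (g ^^ l) ` {p i..p (Suc i)}" using Suc.IH[OF walk] by (rule image_mono)
  finally show ?case by (simp add: image_comp)
qed

text \<open>By convexity, the interval chosen for the left endpoint of such a gap contains no later point. So
different gaps have different intervals, and the interval of the last point belongs to none of them.\<close>
lemma card_separating_gaps:
  fixes p :: "nat \<Rightarrow> real"
  assumes p: "\<And>i j. i \<le> j \<Longrightarrow> j \<le> r \<Longrightarrow> p i \<le> p j"
    and mem: "\<And>i. i \<le> r \<Longrightarrow> \<exists>c\<in>K. p i \<in> C c" and "finite K"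
    and C: "\<And>c. c \<in> K \<Longrightarrow> is_interval (C c)"
  shows "card {i. i < r \<and> \<not> (\<exists>c\<in>K. p i \<in> C c \<and> p (Suc i) \<in> C c)} < card K"
proof -
  define G where "G = {i. i < r \<and> \<not> (\<exists>c\<in>K. p i \<in> C c \<and> p (Suc i) \<in> C c)}"
  \<comment> \<open>An arbitrary choice among the intervals that contain a point, as these may overlap.\<close>
  obtain c where c: "\<And>i. i \<le> r \<Longrightarrow> c i \<in> K \<and> p i \<in> C (c i)"
    using mem by metis
  have neq: "c i \<noteq> c j" if "i \<in> G" "i < j" "j \<le> r" for i j
  proof
    assume eq: "c i = c j"
    have "p i \<le> p (Suc i)" "p (Suc i) \<le> p j" using that by (auto intro!: p)
    moreover have "p i \<in> C (c i)" "p j \<in> C (c i)" "c i \<in> K" using c[of i] c[of j] that eq by auto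
    ultimately have "p (Suc i) \<in> C (c i)" using mem_is_interval_1_I[OF C] by blast
    with \<open>p i \<in> C (c i)\<close> \<open>c i \<in> K\<close> \<open>i \<in> G\<close> show False by (auto simp: G_def)
  qed
  have "inj_on c G"
  proof (rule linorder_inj_onI)
    fix i j assume "i < j" "i \<in> G" "j \<in> G"
    then show "c i \<noteq> c j" by (intro neq) (auto simp: G_def)
  qed auto
  moreover have "c ` G \<subset> K"
  proof
    show "c ` G \<subseteq> K" using c by (force simp: G_def)
    have "c r \<notin> c ` G" using neq[of _ r] unfolding G_def by fastforce
    then show "c ` G \<noteq> K" using c[of r] by auto
  qed
  ultimately have "card G < card K"
    using \<open>finite K\<close> psubset_card_mono[of K "c ` G"] by (simp add: card_image)
  then show ?thesis by (simp add: G_def)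
qed

text \<open>Suppose that no point of \<open>P\<close> itself has a period up to \<open>card K\<close>. Fewer than \<open>card K\<close> gaps of \<open>P\<close>
separate the intervals, so some loop of length at most \<open>card K\<close> starts at a gap that lies inside
one of the intervals. That gap covers itself under an iterate, and the resulting periodic point is in
the interval even though its orbit may leave the union.\<close>
lemma finite_invariant_set_imp_periodic_point:
  fixes g :: "real \<Rightarrow> real"
  assumes g: "continuous_on UNIV g" and P: "finite P" "P \<noteq> {}" "g ` P \<subseteq> P"
    and PC: "P \<subseteq> (\<Union>c\<in>K. C c)" and K: "finite K"
    and C: "\<And>c. c \<in> K \<Longrightarrow> is_interval (C c)"
  obtains x l where "x \<in> (\<Union>c\<in>K. C c)" "1 \<le> l" "l \<le> card K" "(g ^^ l) x = x"
proof (cases "\<exists>x\<in>P. \<exists>l. 1 \<le> l \<and> l \<le> card K \<and> (g ^^ l) x = x")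
  case True
  then show ?thesis using that PC by blast
next
  case False
  define r where "r = card P - 1"
  define p where "p = (\<lambda>i. sorted_list_of_set P ! i)"
  have len: "length (sorted_list_of_set P) = Suc r" using P by (auto simp: r_def card_gt_0_iff)
  have pmono: "p i \<le> p j" if "i \<le> j" "j \<le> r" for i j
    using that len by (auto simp: p_def intro!: sorted_nth_mono)
  have pP: "p i \<in> P" if "i \<le> r" for i
    using nth_mem[of i "sorted_list_of_set P"] that len P by (simp add: p_def)
  have "\<exists>j\<le>r. p j = x" if "x \<in> P" for x
    using that P len by (metis in_set_conv_nth less_Suc_eq_le p_def set_sorted_list_of_set)
  then have "\<exists>j\<le>r. p j = g (p i)" if "i \<le> r" for i using pP[OF that] P(3) by blast
  then obtain \<sigma> where \<sigma>: "\<And>i. i \<le> r \<Longrightarrow> \<sigma> i \<le> r" "\<And>i. i \<le> r \<Longrightarrow> g (p i) = p (\<sigma> i)" by metis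
  have iter: "(\<sigma> ^^ l) i \<le> r \<and> (g ^^ l) (p i) = p ((\<sigma> ^^ l) i)" if "i \<le> r" for i l
    using that by (induction l) (auto simp: \<sigma>)
  have nofix: "(\<sigma> ^^ l) i \<noteq> i" if "i \<le> r" "1 \<le> l" "l \<le> card K" for i l
    using False iter[of i l] pP that by metis
  define G where "G = {i. i < r \<and> \<not> (\<exists>c\<in>K. p i \<in> C c \<and> p (Suc i) \<in> C c)}"
  have "card G < card K"
    unfolding G_def
  proof (rule card_separating_gaps[OF pmono _ K C])
    show "\<exists>c\<in>K. p i \<in> C c" if "i \<le> r" for i using pP[OF that] PC by blast
  qed
  then obtain b l where b: "b < r" "b \<notin> G" and l: "1 \<le> l" "l \<le> card K"
    and loop: "(b, b) \<in> arcs {..<r} (gap_matrix \<sigma>) ^^ l"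
    using short_loop_outside[of r \<sigma> "card K" G] \<sigma> nofix by (auto simp: G_def)
  have "{p b..p (Suc b)} \<subseteq> (g ^^ l) ` {p b..p (Suc b)}"
    by (rule walk_imp_covers[where \<sigma> = \<sigma> and r = r]) (use g pmono \<sigma> loop in auto)
  moreover have "p b \<le> p (Suc b)" using b by (intro pmono) auto
  ultimately obtain x where x: "x \<in> {p b..p (Suc b)}" "(g ^^ l) x = x"
    using self_covering_interval_fixpoint[OF continuous_on_funpow[OF g]] by blast
  obtain c where c: "c \<in> K" "p b \<in> C c" "p (Suc b) \<in> C c" using b by (auto simp: G_def)
  have "x \<in> C c"
    using x(1) by (intro mem_is_interval_1_I[OF C[OF c(1)] c(2,3)]) auto
  then show ?thesis using that c x l by blast
qed

section \<open>Approximation by maps with a finite invariant set\<close>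

text \<open>Otherwise there are maps \<open>g m\<close> converging uniformly to \<open>f\<close> with fixed points \<open>x m \<in> U\<close> of their \<open>l\<close>-th
iterates; a limit point of these is fixed by the \<open>l\<close>-th iterate of \<open>f\<close>.\<close>
lemma no_periodic_point_stable:
  fixes f :: "real \<Rightarrow> real"
  assumes f: "continuous_on UNIV f" and U: "compact U" and nofix: "\<And>x. x \<in> U \<Longrightarrow> (f ^^ l) x \<noteq> x"
  obtains \<epsilon> where "\<epsilon> > 0" "\<And>g x. (\<And>y. \<bar>g y - f y\<bar> \<le> \<epsilon>) \<Longrightarrow> x \<in> U \<Longrightarrow> (g ^^ l) x \<noteq> x"
proof (rule ccontr)
  assume "\<not> thesis"
  have "\<exists>g x. (\<forall>y. \<bar>g y - f y\<bar> \<le> 1 / real (Suc m)) \<and> x \<in> U \<and> (g ^^ l) x = x" for m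
  proof (rule ccontr)
    assume "\<not> ?thesis"
    then have thesis by (intro that[of "1 / real (Suc m)"]) auto
    with \<open>\<not> thesis\<close> show False by contradiction
  qed
  then obtain g x where gf: "\<And>m y. \<bar>g m y - f y\<bar> \<le> 1 / real (Suc m)"
    and x: "\<And>m. x m \<in> U" "\<And>m. (g m ^^ l) (x m) = x m" by metis
  obtain z \<rho> where z: "z \<in> U" "strict_mono \<rho>" "(x \<circ> \<rho>) \<longlonglongrightarrow> z"
    using U x(1) unfolding compact_def by metis
  have inv: "(\<lambda>m. 1 / real (Suc (\<rho> m))) \<longlonglongrightarrow> 0"
    using LIMSEQ_subseq_LIMSEQ[OF lim_1_over_n[THEN LIMSEQ_Suc] z(2)] by (simp add: o_def)
  have "(\<lambda>m. (g (\<rho> m) ^^ k) (x (\<rho> m))) \<longlonglongrightarrow> (f ^^ k) z" for k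
  proof (induction k)
    case 0
    then show ?case using z by (simp add: o_def)
  next
    case (Suc k)
    let ?y = "\<lambda>m. (g (\<rho> m) ^^ k) (x (\<rho> m))"
    have "isCont f ((f ^^ k) z)" using f by (simp add: continuous_on_eq_continuous_at)
    then have "(\<lambda>m. f (?y m)) \<longlonglongrightarrow> f ((f ^^ k) z)" using Suc isCont_tendsto_compose by blast
    moreover have "(\<lambda>m. g (\<rho> m) (?y m) - f (?y m)) \<longlonglongrightarrow> 0"
      by (rule Lim_null_comparison[OF _ inv], rule always_eventually) (simp only: gf real_norm_def simp_thms)
    ultimately have "(\<lambda>m. g (\<rho> m) (?y m) - f (?y m) + f (?y m)) \<longlonglongrightarrow> 0 + f ((f ^^ k) z)"
      by (intro tendsto_add)
    then show ?case by simp
  qed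
  from this[of l] have "(x \<circ> \<rho>) \<longlonglongrightarrow> (f ^^ l) z" by (simp add: x o_def)
  then have "(f ^^ l) z = z" using z LIMSEQ_unique by blast
  with nofix z show False by blast
qed

text \<open>The inclusion \<open>U \<subseteq> f ` U\<close> gives an infinite backward orbit in \<open>U\<close>, and compactness gives two terms
of it that are close to each other. The orbit segment between them is closed up to a finite
invariant set by a small change of \<open>f\<close> near a single point.\<close>
lemma close_map_with_finite_invariant_set:
  fixes f :: "real \<Rightarrow> real"
  assumes f: "continuous_on UNIV f" and U: "compact U" "U \<noteq> {}" "U \<subseteq> f ` U" and "\<epsilon> > 0"
  obtains g P where "continuous_on UNIV g" "\<And>x. \<bar>g x - f x\<bar> \<le> \<epsilon>"
    "finite P" "P \<noteq> {}" "P \<subseteq> U" "g ` P \<subseteq> P"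
proof -
  from U(2) obtain x0 where "x0 \<in> U" by blast
  have "\<exists>x\<in>U. f x = y" if "y \<in> U" for y using U(3) that by (auto simp: image_def)
  then obtain h where h: "\<And>y. y \<in> U \<Longrightarrow> h y \<in> U" "\<And>y. y \<in> U \<Longrightarrow> f (h y) = y" by metis
  define b where "b = (\<lambda>s. (h ^^ s) x0)"
  have bU: "b s \<in> U" for s unfolding b_def by (rule funpow_mem[OF h(1) \<open>x0 \<in> U\<close>])
  have fb: "f (b (Suc s)) = b s" for s using h(2)[OF bU[of s]] by (simp add: b_def)
  obtain z \<rho> where "z \<in> U" and \<rho>: "strict_mono \<rho>" "(b \<circ> \<rho>) \<longlonglongrightarrow> z"
    using U(1) bU unfolding compact_def by metis
  then have "Cauchy (b \<circ> \<rho>)" using LIMSEQ_imp_Cauchy by blast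
  then obtain M where M: "\<And>m n. m \<ge> M \<Longrightarrow> n \<ge> M \<Longrightarrow> dist (b (\<rho> m)) (b (\<rho> n)) < \<epsilon>"
    using \<open>\<epsilon> > 0\<close> unfolding Cauchy_def o_def by blast
  define i j where "i = \<rho> M" and "j = \<rho> (Suc M)"
  have ij: "i < j" using \<rho> by (simp add: i_def j_def strict_mono_def)
  have close: "\<bar>b j - b i\<bar> \<le> \<epsilon>" using M[of "Suc M" M] by (simp add: i_def j_def dist_real_def)
  \<comment> \<open>On \<open>P\<close> only \<open>b (Suc i)\<close> needs a new image: \<open>f\<close> sends it to \<open>b i\<close>, and it is redirected to the nearby
    point \<open>b j\<close> by adding a multiple of a tent function that is zero on the rest of \<open>P\<close>.\<close>
  define P where "P = b ` {i<..j}"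
  have P: "finite P" "P \<noteq> {}" "P \<subseteq> U" using ij bU by (auto simp: P_def)
  define a where "a = b (Suc i)"
  obtain d where d: "d > 0" "\<And>x. x \<in> P \<Longrightarrow> x \<noteq> a \<Longrightarrow> d \<le> dist a x"
    using finite_set_avoid[OF P(1), of a] by blast
  define \<phi> where "\<phi> = (\<lambda>x. max 0 (1 - \<bar>x - a\<bar> / d))"
  define g where "g = (\<lambda>x. f x + (b j - b i) * \<phi> x)"
  show ?thesis
  proof (rule that[of g P])
    show "continuous_on UNIV g" unfolding g_def \<phi>_def by (intro continuous_intros f) (use d in auto)
    show "\<bar>g x - f x\<bar> \<le> \<epsilon>" for x
    proof -
      have "0 \<le> \<phi> x" "\<phi> x \<le> 1" using d by (auto simp: \<phi>_def)
      then have "\<bar>b j - b i\<bar> * \<phi> x \<le> \<epsilon> * 1" using close \<open>\<epsilon> > 0\<close> by (intro mult_mono) auto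
      then show ?thesis using \<open>0 \<le> \<phi> x\<close> by (simp add: g_def abs_mult)
    qed
    show "g ` P \<subseteq> P"
    proof
      fix y assume "y \<in> g ` P"
      then obtain x where x: "x \<in> P" "y = g x" by blast
      show "y \<in> P"
      proof (cases "x = a")
        case True
        then have "y = b j" using x fb[of i] by (simp add: g_def \<phi>_def a_def)
        then show ?thesis using ij by (simp add: P_def)
      next
        case False
        then have "1 \<le> \<bar>x - a\<bar> / d"
          using d(1) d(2)[OF x(1) False] by (simp add: dist_real_def abs_minus_commute[of a])
        then have "\<phi> x = 0" by (simp add: \<phi>_def)
        then have y: "y = f x" using x by (simp add: g_def)
        obtain s where s: "x = b s" "i < s" "s \<le> j" using x(1) unfolding P_def by auto
        have "s \<noteq> Suc i" using False s(1) unfolding a_def by blast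
        moreover obtain t where t: "s = Suc t" using s(2) by (cases s) auto
        ultimately have "t \<in> {i<..j}" using s by auto
        moreover have "y = b t" unfolding y s(1) t by (rule fb)
        ultimately show ?thesis unfolding P_def by blast
      qed
    qed
  qed (use P in auto)
qed

text \<open>The statement for any number of intervals. If \<open>f\<close> had no periodic point of the required kind, neither
would any map uniformly close to \<open>f\<close>, including those that have a finite invariant set in the union.\<close>
theorem interval_cover_periodic_point:
  fixes f :: "real \<Rightarrow> real"
  assumes f: "continuous_on UNIV f" and K: "finite K" 
    and C: "\<And>c. c \<in> K \<Longrightarrow> is_interval (C c) \<and> compact (C c)"
    and ne: "(\<Union>c\<in>K. C c) \<noteq> {}" and cov: "(\<Union>c\<in>K. C c) \<subseteq> f ` (\<Union>c\<in>K. C c)"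
  shows "\<exists>x \<in> (\<Union>c\<in>K. C c). \<exists>l. 1 \<le> l \<and> l \<le> card K \<and> (f ^^ l) x = x"
proof (rule ccontr)
  let ?U = "\<Union>c\<in>K. C c"
  assume none: "\<not> ?thesis"
  have U: "compact ?U" using K C by (intro compact_UN) auto
  have "\<exists>\<epsilon>>0. \<forall>g. (\<forall>y. \<bar>g y - f y\<bar> \<le> \<epsilon>) \<longrightarrow> (\<forall>x\<in>?U. (g ^^ l) x \<noteq> x)"
    if "l \<in> {1..card K}" for l
    using no_periodic_point_stable[OF f U, of l] none that by (metis atLeastAtMost_iff)
  then obtain \<epsilon> where \<epsilon>: "\<And>l. l \<in> {1..card K} \<Longrightarrow> \<epsilon> l > 0"
    "\<And>l g x. l \<in> {1..card K} \<Longrightarrow> (\<And>y. \<bar>g y - f y\<bar> \<le> \<epsilon> l) \<Longrightarrow> x \<in> ?U \<Longrightarrow> (g ^^ l) x \<noteq> x"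
    by metis
  \<comment> \<open>The element \<open>1\<close> only keeps the set nonempty.\<close>
  define \<delta> where "\<delta> = Min (insert 1 (\<epsilon> ` {1..card K}))"
  have "\<delta> > 0" using \<epsilon>(1) by (auto simp: \<delta>_def)
  from close_map_with_finite_invariant_set[OF f U ne cov this] obtain g P where
    g: "continuous_on UNIV g" "\<And>x. \<bar>g x - f x\<bar> \<le> \<delta>"
    and P: "finite P" "P \<noteq> {}" "P \<subseteq> ?U" "g ` P \<subseteq> P" by blast
  obtain x l where x: "x \<in> ?U" "(g ^^ l) x = x" and l: "l \<in> {1..card K}"
    using finite_invariant_set_imp_periodic_point[OF g(1) P(1,2,4,3) K] C by (metis atLeastAtMost_iff)
  have "\<delta> \<le> \<epsilon> l" unfolding \<delta>_def using l by (intro Min_le) auto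
  then have "\<bar>g y - f y\<bar> \<le> \<epsilon> l" for y using g(2)[of y] by linarith
  with \<epsilon>(2)[OF l _ x(1)] x(2) show False by blast
qed

theorem theorem1p3:
  fixes f :: "real \<Rightarrow> real" and I :: "nat \<Rightarrow> real set"
  assumes "continuous_on UNIV f"
    and "\<forall>i\<in>{1..5}. closed_bounded_interval (I i)"
    and "covering_system 5 I f"
  shows "\<exists>x0 \<in> (\<Union>i\<in>{1..5}. I i). \<exists>l::nat. 1 \<le> l \<and> l \<le> 5 \<and> (f ^^ l) x0 = x0"
proof -
  have I: "is_interval (I i) \<and> compact (I i) \<and> I i \<noteq> {}" if "i \<in> {1..5}" for i
  proof -
    have "closed_bounded_interval (I i)" using assms(2) that by (rule bspec)
    then obtain a b where "a \<le> b" "I i = {a..b}" unfolding closed_bounded_interval_def by blast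
    then show ?thesis by (simp add: is_interval_cc)
  qed
  have ne: "(\<Union>i\<in>{1..5}. I i) \<noteq> {}" using I[of 1] by auto
  have cov: "(\<Union>i\<in>{1..5}. I i) \<subseteq> f ` (\<Union>i\<in>{1..5}. I i)"
    using assms(3) unfolding covering_system_def by (elim conjE)
  have "\<exists>x\<in>(\<Union>i\<in>{1..5}. I i). \<exists>l. 1 \<le> l \<and> l \<le> card {1..5::nat} \<and> (f ^^ l) x = x"
    by (rule interval_cover_periodic_point[OF assms(1) _ _ ne cov]) (use I in simp_all)
  then show ?thesis by simp
qed

end
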